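(* For every $n\in\mathbb{N}$, the following identity holds in $\mathbb{Q}(X,Y,Z)$: $$\sum_{I\subseteq[n-1]_0}\binom{n}{I}_{X^{-1}}(YX^{-i_1-1};X^{-1})_{n-i_1}\prod_{i\in I}\frac{(X^iZ)^{n-i}}{1-(X^iZ)^{n-i}}=\frac{(X^{-n}YZ;X)_n}{(Z;X)_n}.$$
   Context: $X,Y,Z$ are indeterminates and $[n-1]_0=\{0,1,\dots,n-1\}$. For $I=\{i_1<\dots<i_l\}\subseteq[n-1]_0$, $i_1$ is the least element of $I$, with the convention $i_1=n$ if $I=\varnothing$. Put $(\underline{N})_X!=\prod_{k=1}^N(1-X^k)$, $\binom{a}{b}_X=\frac{(\underline a)_X!}{(\underline{a-b})_X!\,(\underline b)_X!}$ for $a\ge b\ge0$, $\binom{n}{I}_X=\binom{n}{i_l}_X\binom{i_l}{i_{l-1}}_X\cdots\binom{i_2}{i_1}_X$ (equal to $1$ for $I=\varnothing$), and $(X;Y)_k=\prod_{i=0}^{k-1}(1-XY^i)$ (equal to $1$ for $k=0$). *)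

theory Defs
  imports "HOL-Computational_Algebra.Polynomial_Factorial"
begin

(* Elements of rat poly poly poly are polynomials in Z whose coefficients are polynomials in Y
   over \<rat>[X]: the innermost variable is X, the outermost one is Z. *)
type_synonym ratfun3 = "rat poly poly poly fract"

definition indet_X :: ratfun3 where
  "indet_X = to_fract [:[:[:0, 1:]:]:]"

definition indet_Y :: ratfun3 where
  "indet_Y = to_fract [:[:0, 1:]:]"

definition indet_Z :: ratfun3 where
  "indet_Z = to_fract [:0, 1:]"

definition q_factorial :: "'a::field \<Rightarrow> nat \<Rightarrow> 'a" where
  "q_factorial q N = (\<Prod>k = 1..N. 1 - q ^ k)"

(* Only meaningful for a \<ge> b, because a - b is truncated. *)
definition q_binomial :: "'a::field \<Rightarrow> nat \<Rightarrow> nat \<Rightarrow> 'a" where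
  "q_binomial q a b = q_factorial q a / (q_factorial q (a - b) * q_factorial q b)"

(* For a decreasing list [i_l, ..., i_1] this is
   q_binomial q n i_l * q_binomial q i_l i_(l-1) * ... * q_binomial q i_2 i_1. *)
fun q_binomial_chain :: "'a::field \<Rightarrow> nat \<Rightarrow> nat list \<Rightarrow> 'a" where
  "q_binomial_chain q n [] = 1"
| "q_binomial_chain q n (i # is) = q_binomial q n i * q_binomial_chain q i is"

definition q_multinomial :: "'a::field \<Rightarrow> nat \<Rightarrow> nat set \<Rightarrow> 'a" where
  "q_multinomial q n I = q_binomial_chain q n (rev (sorted_list_of_set I))"

definition q_pochhammer :: "'a::field \<Rightarrow> 'a \<Rightarrow> nat \<Rightarrow> 'a" where
  "q_pochhammer a q k = (\<Prod>i<k. 1 - a * q ^ i)"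

definition least_or :: "nat \<Rightarrow> nat set \<Rightarrow> nat" where
  "least_or n I = (if I = {} then n else Min I)"

end

theory Submission
  imports Defs
begin

(* Grouping the sum by the least element of I reduces the left side to
   a sum over j of c_j (Y X^(-j-1); X^(-1))_(n-j), where c_j collects all chains ending in j and
   satisfies c_n = 1 and c_j = u_j * (sum over i \<ge> j of c_i (i choose j)_(1/X)), u_j = (X^j Z)^(n-j).
   This recursion is solved by c_j = (n choose j)_X Z^(n-j) (Z;X)_j / (Z;X)_n.  Both the recursion and
   the resulting evaluation are instances of one identity of q-Chu-Vandermonde type,
   which follows by induction from the q-Pascal rule. *)

section \<open>Products: q-factorials and q-Pochhammer symbols\<close>

lemma q_factorial_0 [simp]: "q_factorial q 0 = 1"
  by (simp add: q_factorial_def)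

lemma q_factorial_Suc: "q_factorial q (Suc n) = q_factorial q n * (1 - q ^ Suc n)"
  by (simp add: q_factorial_def)

lemma q_pochhammer_0 [simp]: "q_pochhammer a q 0 = 1"
  by (simp add: q_pochhammer_def)

lemma q_pochhammer_Suc: "q_pochhammer a q (Suc n) = q_pochhammer a q n * (1 - a * q ^ n)"
  by (simp add: q_pochhammer_def)

lemma q_pochhammer_Suc': "q_pochhammer a q (Suc n) = (1 - a) * q_pochhammer (a * q) q n"
  unfolding q_pochhammer_def by (subst prod.lessThan_Suc_shift) (simp add: mult_ac)

lemma q_pochhammer_add:
  "q_pochhammer a q (m + n) = q_pochhammer a q m * q_pochhammer (a * q ^ m) q n"
  by (induction n) (simp_all add: q_pochhammer_Suc power_add mult_ac)

lemma q_pochhammer_zero [simp]: "q_pochhammer 0 q n = 1"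
  by (simp add: q_pochhammer_def)

lemma q_factorial_inverse:
  assumes "q \<noteq> (0 :: 'a :: field)"
  shows "q_factorial (inverse q) n = (\<Prod>k = 1..n. - (inverse q ^ k)) * q_factorial q n"
proof -
  have "1 - inverse q ^ k = - (inverse q ^ k) * (1 - q ^ k)" for k
    using assms by (simp add: field_simps)
  thus ?thesis
    unfolding q_factorial_def prod.distrib [symmetric] by (intro prod.cong) auto
qed

text \<open>Each of the last r factors, k = m + i, is p^m times the factor -(p^i); this yields the
  surplus p^(m * r).\<close>

lemma prod_uminus_power_add:
  "(\<Prod>k = 1..m + r. - ((p :: 'a :: field) ^ k))
     = (\<Prod>k = 1..m. - (p ^ k)) * (\<Prod>k = 1..r. - (p ^ k)) * p ^ (m * r)"
  by (induction r) (simp_all add: power_add mult_ac)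

text \<open>The signs and powers from \<open>q_factorial_inverse\<close> cancel up to that surplus.
  Writing m + r avoids truncated subtraction.\<close>

lemma q_binomial_inverse:
  assumes "q \<noteq> (0 :: 'a :: field)"
  shows "q_binomial (inverse q) (m + r) m = inverse q ^ (m * r) * q_binomial q (m + r) m"
proof -
  have nz: "(\<Prod>k = 1..n. - (inverse q ^ k)) \<noteq> 0" for n
    using assms by simp
  have "q_binomial (inverse q) (m + r) m =
      ((\<Prod>k = 1..m. - (inverse q ^ k)) * (\<Prod>k = 1..r. - (inverse q ^ k)))
      * (inverse q ^ (m * r) * q_factorial q (m + r))
      / (((\<Prod>k = 1..m. - (inverse q ^ k)) * (\<Prod>k = 1..r. - (inverse q ^ k)))
      * (q_factorial q r * q_factorial q m))"
    unfolding q_binomial_def q_factorial_inverse [OF assms] prod_uminus_power_add by (simp add: mult_ac)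
  also have "\<dots> = inverse q ^ (m * r) * q_factorial q (m + r) / (q_factorial q r * q_factorial q m)"
    by (rule mult_divide_mult_cancel_left) (use nz [of m] nz [of r] in \<open>simp only: mult_eq_0_iff\<close>, simp)
  finally show ?thesis by (simp add: q_binomial_def)
qed

section \<open>Adjoining a new least element to a subset\<close>

lemma q_binomial_chain_snoc:
  "q_binomial_chain q n (xs @ [j]) = q_binomial_chain q n xs * q_binomial q (last (n # xs)) j"
  by (induction xs arbitrary: n) (auto simp: mult_ac)

text \<open>Putting n in front makes the empty list return n, the convention for the empty
  set.\<close>

lemma last_rev_sorted_list:
  assumes "finite I"
  shows "last (n # rev (sorted_list_of_set I)) = least_or n I"
proof (cases "I = {}")
  case False
  then show ?thesis
    using assms by (simp add: least_or_def last_rev sorted_list_of_set_nonempty)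
qed (simp add: least_or_def)

text \<open>The new least element comes last in the reversed list, so exactly one binomial is added,
  linking j to the former least element.\<close>

lemma q_multinomial_insert_least:
  assumes "finite I" "\<And>i. i \<in> I \<Longrightarrow> j < i"
  shows "q_multinomial q n (insert j I) = q_multinomial q n I * q_binomial q (least_or n I) j"
proof -
  have "sorted_list_of_set (insert j I) = j # sorted_list_of_set I"
    using assms by (metis insort_is_Cons less_imp_le order_less_irrefl
        set_sorted_list_of_set sorted_list_of_set_insert)
  thus ?thesis
    by (simp only: q_multinomial_def rev.simps q_binomial_chain_snoc last_rev_sorted_list [OF assms(1)])
qed

lemma least_or_insert_least:
  assumes "finite I" "\<And>i. i \<in> I \<Longrightarrow> j < i"
  shows "least_or n (insert j I) = j"
  unfolding least_or_def using assms by (auto intro!: Min_eqI simp: less_imp_le)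

section \<open>Gaussian binomials in a base x that is not a root of unity\<close>

context
  fixes x :: "'a :: field"
  assumes not_root: "\<And>k. k > 0 \<Longrightarrow> x ^ k \<noteq> 1"
begin

lemma q_factorial_nonzero: "q_factorial x n \<noteq> 0"
  unfolding q_factorial_def using not_root by (auto simp: prod_zero_iff)

lemma q_binomial_0: "q_binomial x n 0 = 1"
  using q_factorial_nonzero by (simp add: q_binomial_def)

lemma q_binomial_self: "q_binomial x n n = 1"
  using q_factorial_nonzero by (simp add: q_binomial_def)

text \<open>The q-Pascal rule, from 1 - s * t = (1 - s) + s * (1 - t). The case j = n is excluded
  because \<open>q_binomial x n (Suc n)\<close> is not 0 under truncated subtraction.\<close>

lemma q_binomial_Suc:
  assumes "j < n"
  shows "q_binomial x (Suc n) (Suc j) = q_binomial x n j + x ^ Suc j * q_binomial x n (Suc j)"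
proof -
  obtain r where n: "n = Suc (j + r)"
    using less_imp_Suc_add [OF assms] by auto
  have nz: "1 - x ^ Suc k \<noteq> 0" for k
    using not_root [of "Suc k"] by simp
  define A B C where "A = q_factorial x j" "B = q_factorial x r" "C = q_factorial x n"
  have ABC: "A \<noteq> 0" "B \<noteq> 0"
    using q_factorial_nonzero by (auto simp: A_B_C_def)
  define s t where "s = x ^ Suc j" "t = x ^ Suc r"
  have st: "1 - s \<noteq> 0" "1 - t \<noteq> 0" "x ^ Suc n = s * t"
    using nz [of j] nz [of r] by (simp_all add: s_t_def n power_add)
  have "q_binomial x (Suc n) (Suc j) = C * (1 - s * t) / ((B * (1 - t)) * (A * (1 - s)))"
    using st(3) by (simp add: q_binomial_def n q_factorial_Suc A_B_C_def s_t_def Suc_diff_le)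
  also have "\<dots> = C / ((B * (1 - t)) * A) + s * (C / (B * (A * (1 - s))))"
    using ABC st by (simp add: divide_simps) (simp add: algebra_simps)
  also have "\<dots> = q_binomial x n j + s * q_binomial x n (Suc j)"
    by (simp add: q_binomial_def n q_factorial_Suc A_B_C_def s_t_def Suc_diff_le)
  finally show ?thesis by (simp add: s_t_def)
qed

text \<open>Trinomial revision: after cancellation both sides are the q-factorial of j + m over
  those of j, r and m - r.\<close>

lemma q_binomial_mult:
  "q_binomial x (j + m) (j + r) * q_binomial x (j + r) j = q_binomial x (j + m) j * q_binomial x m r"
  using q_factorial_nonzero by (simp add: q_binomial_def field_simps)

text \<open>q-Pascal under the sum: with f arbitrary, lowering \<open>Suc n\<close> to n becomes a
  mere rewriting of the summand, as the induction below needs.\<close>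

lemma sum_q_binomial_Suc:
  "(\<Sum>j\<le>Suc n. q_binomial x (Suc n) j * f j)
     = (\<Sum>j\<le>n. q_binomial x n j * (x ^ j * f j + f (Suc j)))"
proof -
  \<comment> \<open>The two end terms are split off, since the q-Pascal rule covers only the inner
    indices.\<close>
  have "(\<Sum>j\<le>Suc n. q_binomial x (Suc n) j * f j)
      = f 0 + (\<Sum>j<n. q_binomial x (Suc n) (Suc j) * f (Suc j)) + f (Suc n)"
    unfolding sum.atMost_Suc_shift unfolding lessThan_Suc_atMost [symmetric]
    by (simp add: q_binomial_0 q_binomial_self add.assoc)
  also have "(\<Sum>j<n. q_binomial x (Suc n) (Suc j) * f (Suc j)) =
      (\<Sum>j<n. q_binomial x n j * f (Suc j)) + (\<Sum>j<n. x ^ Suc j * q_binomial x n (Suc j) * f (Suc j))"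
    unfolding sum.distrib [symmetric] by (intro sum.cong) (auto simp: q_binomial_Suc algebra_simps)
  also have "f 0 + (\<dots>) + f (Suc n) =
      (f 0 + (\<Sum>j<n. x ^ Suc j * q_binomial x n (Suc j) * f (Suc j)))
       + ((\<Sum>j<n. q_binomial x n j * f (Suc j)) + f (Suc n))"
    by (simp add: add_ac)
  also have "f 0 + (\<Sum>j<n. x ^ Suc j * q_binomial x n (Suc j) * f (Suc j))
      = (\<Sum>j\<le>n. q_binomial x n j * (x ^ j * f j))"
    unfolding lessThan_Suc_atMost [symmetric]
    by (subst sum.lessThan_Suc_shift) (simp add: q_binomial_0 mult_ac)
  also have "(\<Sum>j<n. q_binomial x n j * f (Suc j)) + f (Suc n) = (\<Sum>j\<le>n. q_binomial x n j * f (Suc j))"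
    unfolding lessThan_Suc_atMost [symmetric] by (simp add: q_binomial_self)
  finally show ?thesis
    by (simp only: distrib_left sum.distrib)
qed

text \<open>The identity of q-Chu-Vandermonde type. Each induction step pulls out 1 - y * z / x and
  replaces y by y / x, hence y is arbitrary in the induction.\<close>

lemma q_binomial_pochhammer_sum:
  assumes x0: "x \<noteq> 0"
  shows "(\<Sum>j\<le>n. q_binomial x n j *
            (z ^ (n - j) * q_pochhammer z x j * q_pochhammer (y * inverse x ^ Suc j) (inverse x) (n - j)))
         = q_pochhammer (inverse x ^ n * y * z) x n"
proof (induction n arbitrary: y)
  case 0
  show ?case by (simp add: q_binomial_def)
next
  case (Suc n)
  let ?p = "inverse x"
  define t where "t y j = q_binomial x n j *
     (z ^ (n - j) * q_pochhammer z x j * q_pochhammer (y * ?p ^ Suc j) ?p (n - j))" for y j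
  have "(\<Sum>j\<le>Suc n. q_binomial x (Suc n) j * (z ^ (Suc n - j) * q_pochhammer z x j
          * q_pochhammer (y * ?p ^ Suc j) ?p (Suc n - j))) = (\<Sum>j\<le>n. (1 - ?p * y * z) * t (?p * y) j)"
    unfolding sum_q_binomial_Suc
  proof (intro sum.cong refl)
    fix j assume "j \<in> {..n}"
    hence 1: "Suc n - j = Suc (n - j)" by auto
    have 2: "y * ?p ^ Suc j * ?p = ?p * y * ?p ^ Suc j" "y * ?p ^ Suc (Suc j) = ?p * y * ?p ^ Suc j"
      by (simp_all add: mult_ac)
    \<comment> \<open>The terms in z * x^j cancel, so this factor does not depend on j and leaves
      the sum.\<close>
    have 3: "x ^ j * (z * (1 - y * ?p ^ Suc j)) + (1 - z * x ^ j) = 1 - ?p * y * z"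
      using x0 by (simp add: field_simps)
    define B Q P where "B = q_binomial x n j" "Q = z ^ (n - j) * q_pochhammer z x j"
      "P = q_pochhammer (?p * y * ?p ^ Suc j) ?p (n - j)"
    have "q_binomial x n j *
          (x ^ j * (z ^ (Suc n - j) * q_pochhammer z x j * q_pochhammer (y * ?p ^ Suc j) ?p (Suc n - j))
           + z ^ (Suc n - Suc j) * q_pochhammer z x (Suc j)
              * q_pochhammer (y * ?p ^ Suc (Suc j)) ?p (Suc n - Suc j))
        = B * (Q * P) * (x ^ j * (z * (1 - y * ?p ^ Suc j)) + (1 - z * x ^ j))"
      unfolding 1 q_pochhammer_Suc' [of "y * ?p ^ Suc j"] q_pochhammer_Suc [of z] 2 diff_Suc_Suc B_Q_P_def
      by (simp only: power_Suc) (simp only: algebra_simps)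
    thus "q_binomial x n j *
          (x ^ j * (z ^ (Suc n - j) * q_pochhammer z x j * q_pochhammer (y * ?p ^ Suc j) ?p (Suc n - j))
           + z ^ (Suc n - Suc j) * q_pochhammer z x (Suc j)
              * q_pochhammer (y * ?p ^ Suc (Suc j)) ?p (Suc n - Suc j))
        = (1 - ?p * y * z) * t (?p * y) j"
      unfolding 3 t_def B_Q_P_def by (simp only: mult_ac)
  qed
  also have "\<dots> = (1 - ?p * y * z) * (\<Sum>j\<le>n. t (?p * y) j)"
    by (simp only: sum_distrib_left)
  also have "(\<Sum>j\<le>n. t (?p * y) j) = q_pochhammer (?p ^ n * (?p * y) * z) x n"
    unfolding t_def by (rule Suc.IH)
  \<comment> \<open>The extracted factor is the last one of the longer product, because ?p^(n+1) *
    x^n = ?p.\<close>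
  also have "(1 - ?p * y * z) * \<dots> = q_pochhammer (?p ^ Suc n * y * z) x (Suc n)"
    using x0 by (simp add: q_pochhammer_Suc mult_ac power_inverse)
  finally show ?case .
qed

section \<open>The weights c_j of the chains ending in j\<close>

context
  fixes z :: 'a and n :: nat
  assumes x0: "x \<noteq> 0"
    and not_pole: "\<And>i k. i < n \<Longrightarrow> k > 0 \<Longrightarrow> (x ^ i * z) ^ k \<noteq> 1"
begin

text \<open>The closed form of c_j is taken as the definition; its link to chains is supplied by
  \<open>sum_over_subsets\<close>.\<close>

definition chain_weight :: "nat \<Rightarrow> 'a" where
  "chain_weight j = q_binomial x n j * (z ^ (n - j) * q_pochhammer z x j) / q_pochhammer z x n"

lemma pochhammer_nonzero: "q_pochhammer z x n \<noteq> 0"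
  unfolding q_pochhammer_def using not_pole [of _ 1] by (auto simp: mult_ac)

text \<open>With i = j + r, trinomial revision extracts \<open>chain_weight j\<close>; what remains
  is \<open>q_binomial_pochhammer_sum\<close> for m = n - j, z * x^j and y = 0, whose value is
  1.\<close>

lemma chain_weight_rec:
  assumes "j \<le> n"
  shows "chain_weight j
    = (x ^ j * z) ^ (n - j) * (\<Sum>i = j..n. chain_weight i * q_binomial (inverse x) i j)"
proof -
  obtain m where n: "n = j + m"
    using assms le_Suc_ex by blast
  let ?w = "z * x ^ j"
  have "(\<Sum>i = j..n. chain_weight i * q_binomial (inverse x) i j)
      = (\<Sum>r\<le>m. chain_weight (j + r) * q_binomial (inverse x) (j + r) j)"
    using sum.shift_bounds_cl_nat_ivl
      [of "\<lambda>i. chain_weight i * q_binomial (inverse x) i j" 0 j m]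
    by (simp add: n add.commute atLeast0AtMost)
  hence "(x ^ j * z) ^ (n - j) * (\<Sum>i = j..n. chain_weight i * q_binomial (inverse x) i j)
      = (\<Sum>r\<le>m. ?w ^ m * (chain_weight (j + r) * q_binomial (inverse x) (j + r) j))"
    by (simp add: n sum_distrib_left mult.commute)
  also have "\<dots> = (\<Sum>r\<le>m. chain_weight j * (q_binomial x m r * (?w ^ (m - r) * q_pochhammer ?w x r)))"
  proof (intro sum.cong refl)
    fix r assume "r \<in> {..m}"
    then obtain s where m: "m = r + s"
      using le_Suc_ex by auto
    \<comment> \<open>The power of \<open>inverse x\<close> comes from changing the base of the
      binomial to x. It leaves the z^m of \<open>chain_weight j\<close> times the power of ?w that
      the identity requires.\<close>
    have pw: "?w ^ m * z ^ s * inverse x ^ (j * r) = z ^ m * ?w ^ s"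
      using x0 by (simp add: m power_add power_mult_distrib power_mult [symmetric] field_simps)
    have "?w ^ m * (chain_weight (j + r) * q_binomial (inverse x) (j + r) j)
        = (q_binomial x (j + m) (j + r) * q_binomial x (j + r) j) * (?w ^ m * z ^ s * inverse x ^ (j * r))
           * (q_pochhammer z x j * q_pochhammer ?w x r) / q_pochhammer z x n"
      unfolding q_binomial_inverse [OF x0] chain_weight_def q_pochhammer_add [of z x j r] unfolding n
      by (simp add: m mult_ac)
    also have "\<dots> = chain_weight j * (q_binomial x m r * (?w ^ (m - r) * q_pochhammer ?w x r))"
      unfolding q_binomial_mult pw chain_weight_def unfolding n by (simp add: m mult_ac)
    finally show "?w ^ m * (chain_weight (j + r) * q_binomial (inverse x) (j + r) j)
        = chain_weight j * (q_binomial x m r * (?w ^ (m - r) * q_pochhammer ?w x r))" .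
  qed
  also have "\<dots> = chain_weight j"
    using q_binomial_pochhammer_sum [OF x0, of m ?w 0] by (simp add: sum_distrib_left [symmetric])
  finally show ?thesis by simp
qed

text \<open>Solving the recursion for its term i = j produces the factor u / (1 - u) of the theorem.
  At j = n one would have u = 1.\<close>

lemma chain_weight_step:
  assumes "j < n"
  defines "u \<equiv> (x ^ j * z) ^ (n - j)"
  shows "u / (1 - u) * (\<Sum>i = Suc j..n. chain_weight i * q_binomial (inverse x) i j) = chain_weight j"
proof -
  let ?S = "\<Sum>i = Suc j..n. chain_weight i * q_binomial (inverse x) i j"
  have self: "q_binomial (inverse x) j j = 1"
    using q_binomial_inverse [OF x0, of j 0] q_binomial_self [of j] by simp
  have "chain_weight j = u * (chain_weight j + ?S)"
    using chain_weight_rec [of j] assms(1) unfolding u_def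
    by (simp add: sum.atLeast_Suc_atMost self)
  moreover have "1 - u \<noteq> 0"
    using not_pole [of j "n - j"] assms(1) by (simp add: u_def)
  ultimately show ?thesis
    by (simp add: field_simps)
qed

text \<open>Downward induction on the left end j. Sets containing j arise by adjoining j to a subset
  of \<open>{Suc j..<n}\<close>. The binomial this creates depends only on j and the old least
  element, so it can play the role of g in the induction hypothesis; therefore g is
  arbitrary.\<close>

lemma sum_over_subsets:
  fixes g :: "nat \<Rightarrow> 'a"
  assumes "j \<le> n"
  shows "(\<Sum>I\<in>Pow {j..<n}. q_multinomial (inverse x) n I * g (least_or n I)
            * (\<Prod>i\<in>I. (x ^ i * z) ^ (n - i) / (1 - (x ^ i * z) ^ (n - i))))
         = (\<Sum>i = j..n. chain_weight i * g i)"
  using assms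
proof (induction j arbitrary: g rule: inc_induct)
  case base
  \<comment> \<open>Only the empty set remains, with \<open>least_or\<close> equal to n and
    \<open>chain_weight n\<close> equal to 1.\<close>
  show ?case
    using pochhammer_nonzero
    by (simp add: q_multinomial_def least_or_def chain_weight_def q_binomial_self)
next
  case (step j)
  let ?w = "\<lambda>i. (x ^ i * z) ^ (n - i) / (1 - (x ^ i * z) ^ (n - i))"
  let ?t = "\<lambda>g I. q_multinomial (inverse x) n I * g (least_or n I) * (\<Prod>i\<in>I. ?w i)"
  let ?P = "Pow {Suc j..<n}"
  have fin: "finite I" and gt: "\<And>i. i \<in> I \<Longrightarrow> j < i" if "I \<in> ?P" for I
    using that by (auto intro: finite_subset)
  have "{j..<n} = insert j {Suc j..<n}"
    using step.hyps by auto
  hence "sum (?t g) (Pow {j..<n}) = sum (?t g) ?P + sum (?t g) (insert j ` ?P)"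
    by (simp only: Pow_insert) (rule sum.union_disjoint, auto)
  also have "sum (?t g) (insert j ` ?P) = sum (\<lambda>I. ?t g (insert j I)) ?P"
  proof (intro sum.reindex_cong [OF _ refl refl] inj_onI)
    fix A B assume "A \<in> ?P" "B \<in> ?P" "insert j A = insert j B"
    thus "A = B" using gt [of A] gt [of B] by (metis insert_ident order_less_irrefl)
  qed
  also have "\<dots> = sum (\<lambda>I. ?w j * g j * ?t (\<lambda>i. q_binomial (inverse x) i j) I) ?P"
  proof (intro sum.cong refl)
    fix I assume I: "I \<in> ?P"
    have "j \<notin> I" using gt [OF I] by auto
    thus "?t g (insert j I) = ?w j * g j * ?t (\<lambda>i. q_binomial (inverse x) i j) I"
      by (simp only: q_multinomial_insert_least [OF fin [OF I] gt [OF I]]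
          least_or_insert_least [OF fin [OF I] gt [OF I]] prod.insert [OF fin [OF I] \<open>j \<notin> I\<close>] mult_ac)
  qed
  also have "\<dots> = ?w j * (\<Sum>i = Suc j..n. chain_weight i * q_binomial (inverse x) i j) * g j"
    unfolding step.IH [symmetric] sum_distrib_left sum_distrib_right by (simp only: mult_ac)
  also have "\<dots> = chain_weight j * g j"
    using chain_weight_step step.hyps by simp
  also have "sum (?t g) ?P = (\<Sum>i = Suc j..n. chain_weight i * g i)"
    by (rule step.IH)
  finally show ?case
    using step.hyps by (simp add: sum.atLeast_Suc_atMost)
qed

text \<open>The Pochhammer factor depends on I only through its least element, so it serves as g;
  the identity with general y then evaluates the sum.\<close>

lemma igusa_sum:
  "(\<Sum>I\<in>Pow {..<n}. q_multinomial (inverse x) n I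
        * q_pochhammer (y * inverse x ^ Suc (least_or n I)) (inverse x) (n - least_or n I)
        * (\<Prod>i\<in>I. (x ^ i * z) ^ (n - i) / (1 - (x ^ i * z) ^ (n - i))))
   = q_pochhammer (inverse x ^ n * y * z) x n / q_pochhammer z x n"
proof -
  let ?g = "\<lambda>i. q_pochhammer (y * inverse x ^ Suc i) (inverse x) (n - i)"
  have "(\<Sum>i\<le>n. chain_weight i * ?g i) = q_pochhammer (inverse x ^ n * y * z) x n / q_pochhammer z x n"
    unfolding q_binomial_pochhammer_sum [OF x0, symmetric] chain_weight_def sum_divide_distrib
    by (simp add: mult_ac)
  thus ?thesis
    using sum_over_subsets [of 0 ?g] by (simp add: atLeast0AtMost atLeast0LessThan)
qed

end

end

section \<open>Non-degeneracy of the indeterminates\<close>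

lemma to_fract_power: "to_fract (a ^ k) = to_fract a ^ k"
  by (induction k) simp_all

lemma indet_X_nonzero: "indet_X \<noteq> 0"
  by (simp add: indet_X_def)

text \<open>The embedding into fractions is injective, so degrees in X can be compared: k against
  0.\<close>

lemma indet_X_power_neq_1:
  assumes "k > 0"
  shows "indet_X ^ k \<noteq> 1"
proof
  assume "indet_X ^ k = 1"
  hence "to_fract ([:[:[:0, 1:]:]:] ^ k :: rat poly poly poly) = to_fract 1"
    by (simp add: indet_X_def to_fract_power)
  hence "[:[:[:0, 1:] ^ k:]:] = (1 :: rat poly poly poly)"
    by (simp only: to_fract_eq_iff poly_const_pow)
  hence "[:0, 1:] ^ k = (1 :: rat poly)"
    by (simp add: one_pCons)
  hence "degree ([:0, 1:] ^ k :: rat poly) = 0"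
    by simp
  thus False using assms by (simp add: degree_power_eq)
qed

text \<open>Z is the outermost variable, so \<open>degree\<close> is the degree in Z: k on the left,
  0 on the right.\<close>

lemma indet_XZ_power_neq_1:
  assumes "k > 0"
  shows "(indet_X ^ i * indet_Z) ^ k \<noteq> 1"
proof
  let ?c = "[:[:0, 1:]:] ^ i :: rat poly poly"
  assume "(indet_X ^ i * indet_Z) ^ k = 1"
  hence "to_fract (([:[:[:0, 1:]:]:] ^ i * [:0, 1:]) ^ k :: rat poly poly poly) = to_fract 1"
    by (simp only: indet_X_def indet_Z_def to_fract_power to_fract_mult to_fract_1)
  hence "([:?c:] * [:0, 1:]) ^ k = 1"
    by (simp only: to_fract_eq_iff poly_const_pow)
  hence "degree (([:?c:] * [:0, 1:]) ^ k) = 0"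
    by (simp only: degree_1)
  thus False using assms by (simp add: degree_power_eq)
qed

theorem proposition1p5:
  fixes n :: nat
  shows "(\<Sum>I\<in>Pow {..<n}.
            q_multinomial (inverse indet_X) n I
            * q_pochhammer (indet_Y * indet_X powi (- int (least_or n I) - 1)) (inverse indet_X)
                (n - least_or n I)
            * (\<Prod>i\<in>I. (indet_X ^ i * indet_Z) ^ (n - i) / (1 - (indet_X ^ i * indet_Z) ^ (n - i))))
         = q_pochhammer (indet_X powi (- int n) * indet_Y * indet_Z) indet_X n
           / q_pochhammer indet_Z indet_X n"
proof -
  have 1: "indet_X powi (- int m) = inverse indet_X ^ m" for m
    by (simp add: power_int_minus power_inverse)
  have 2: "indet_X powi (- int m - 1) = inverse indet_X ^ Suc m" for m
    unfolding 1 [symmetric] by (intro arg_cong [where f = "(powi) indet_X"]) simp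
  show ?thesis
    unfolding 1 2
    by (rule igusa_sum [OF indet_X_power_neq_1 indet_X_nonzero indet_XZ_power_neq_1])
qed

end
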